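(* Let $k \geq 3$ be an integer and let $N = 2^k$. Consider the network with $N$ nodes in which every node $i$ shares a key with the nodes $i+1, i+2, i+4, \dots, i+\frac{N}{2}$ (that is, $i+2^j$ for $0 \le j \le k-1$), computed modulo $N$, where sharing a key is a symmetric relation, so that every node shares keys with exactly $2\log_2(N)-1$ other nodes. Then any two nodes can securely communicate in at most $$\left\lfloor \frac{\log_2\left(\frac{N}{8}\right)}{2} \right\rfloor + 2$$ hops; that is, any two nodes are joined by a path of at most this many edges in the graph whose edges are the pairs of nodes that share a key.
   Context: Nodes are labelled by IDs $1,\dots,N$, regarded as residues modulo $N$. The key-sharing graph is the undirected simple graph on the $N$ nodes in which $i$ and $i'$ are adjacent if and only if $i - i' \equiv \pm 2^j \pmod N$ for some $j \in \{0,1,\dots,k-1\}$. Two adjacent nodes share an encryption key and can communicate directly, in either direction, in one hop. Non-adjacent nodes communicate securely by relaying a message along a path of adjacent nodes (the message being decrypted and re-encrypted at each intermediate node); the number of hops is the number of edges of the path. *)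

theory Defs
  imports
    Complex_Main
    "HOL-Number_Theory.Cong"
    "Graph_Theory.Pair_Digraph"
begin

text \<open>
  The two disjuncts say \<open>i' - i \<equiv> 2 ^ j\<close> and \<open>i - i' \<equiv> 2 ^ j\<close> modulo \<open>N\<close>,
  written without the truncating subtraction on \<^typ>\<open>nat\<close>.
\<close>

definition shares_key :: "nat \<Rightarrow> nat \<Rightarrow> nat \<Rightarrow> nat \<Rightarrow> bool" where
  "shares_key k N i i' \<longleftrightarrow> (\<exists>j<k. [i' = i + 2 ^ j] (mod N) \<or> [i = i' + 2 ^ j] (mod N))"

text \<open>
  As usual in \<open>Graph_Theory\<close>, an undirected edge is represented by its two
  orientations. The IDs \<open>1, \<dots>, N\<close> represent the residues modulo \<open>N\<close>, with \<open>N\<close> standing for 0.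
\<close>

definition key_graph :: "nat \<Rightarrow> nat \<Rightarrow> nat pair_pre_digraph" where
  "key_graph k N =
    \<lparr>pverts = {1..N}, parcs = {(i, i'). i \<in> {1..N} \<and> i' \<in> {1..N} \<and> shares_key k N i i'}\<rparr>"

lemma shares_key_sym: "shares_key k N i i' \<longleftrightarrow> shares_key k N i' i"
  unfolding shares_key_def by blast

lemma shares_key_irrefl:
  assumes "N = 2 ^ k"
  shows "\<not> shares_key k N i i"
proof
  assume "shares_key k N i i"
  then obtain j where j: "j < k" "[i = i + 2 ^ j] (mod N)"
    unfolding shares_key_def by blast
  then have "[0 + i = 2 ^ j + i] (mod N)" by (simp add: add.commute)
  then have "[0 = 2 ^ j] (mod N)" by (simp only: cong_add_rcancel_nat)
  then have "N dvd 2 ^ j" by (metis cong_0_iff cong_sym)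
  with assms have "(2::nat) ^ k \<le> 2 ^ j" by (simp add: dvd_imp_le)
  with j(1) show False by simp
qed

lemma pair_graph_key_graph:
  assumes "N = 2 ^ k"
  shows "pair_graph (key_graph k N)"
proof unfold_locales
  show "finite (parcs (key_graph k N))"
    by (rule finite_subset[of _ "{1..N} \<times> {1..N}"]) (auto simp: key_graph_def)
  show "symmetric (key_graph k N)"
    unfolding symmetric_def by (auto intro!: symI simp: key_graph_def shares_key_sym)
qed (use shares_key_irrefl[OF assms] in \<open>auto simp: key_graph_def\<close>)

end

(*
  Two nodes whose difference is a sum of m terms +-2^j are m hops apart, so everything rests on
  writing each residue modulo 2^k as a sum of at most (k + 1) div 2 signed powers of two.
  An even d is doubled from a residue modulo 2^(k-1); for odd d one of d - 1, d + 1 is divisible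
  by 4, so a single term +-1 disposes of two binary digits at once.
*)

theory Submission
  imports Defs
begin

section \<open>Signed binary expansions of residues\<close>

text \<open>Integers rather than residues, so that one set can be scaled and then read modulo
  different powers of two. For \<open>k > 0\<close>, \<open>2 ^ (k - 1)\<close> and its negative are
  distinct here but congruent modulo \<open>2 ^ k\<close>.\<close>

definition signed_powers :: "nat \<Rightarrow> int set" where
  "signed_powers k = (\<lambda>j. 2 ^ j) ` {..<k} \<union> (\<lambda>j. - (2 ^ j)) ` {..<k}"

lemma signed_powers_shift: "x \<in> signed_powers k \<Longrightarrow> 2 ^ m * x \<in> signed_powers (m + k)"
  by (auto simp: signed_powers_def power_add[symmetric])

text \<open>The inductive step for expansions: scaling by \<open>2 ^ m\<close> raises the modulus by
  the same factor and leaves the number of terms unchanged.\<close>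

lemma signed_expansion_shift:
  assumes "set xs \<subseteq> signed_powers k" "[sum_list xs = d] (mod 2 ^ k)"
  shows "set (map ((*) (2 ^ m)) xs) \<subseteq> signed_powers (m + k)"
    and "[sum_list (map ((*) (2 ^ m)) xs) = 2 ^ m * d] (mod 2 ^ (m + k))"
proof -
  show "set (map ((*) (2 ^ m)) xs) \<subseteq> signed_powers (m + k)"
    using assms(1) by (auto intro: signed_powers_shift)
  have "sum_list (map ((*) (2 ^ m)) xs) = 2 ^ m * sum_list xs"
    by (simp add: sum_list_const_mult)
  then show "[sum_list (map ((*) (2 ^ m)) xs) = 2 ^ m * d] (mod 2 ^ (m + k))"
    using assms(2) by (auto simp: power_add intro: cong_cmult_leftI)
qed

text \<open>Strong induction, because the odd case lowers \<open>k\<close> by two. It costs one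
  term, which matches \<open>(k - 2 + 1) div 2 + 1 = (k + 1) div 2\<close>; the even case lowers
  \<open>k\<close> by one at no cost.\<close>

lemma signed_expansion:
  fixes d :: int
  shows "\<exists>xs. set xs \<subseteq> signed_powers k \<and> length xs \<le> (k + 1) div 2 \<and> [sum_list xs = d] (mod 2 ^ k)"
proof (induction k arbitrary: d rule: less_induct)
  case (less k)
  \<comment> \<open>Odd \<open>d\<close> with \<open>k = 1\<close> stands apart: there is no second
    binary digit to remove, and the single term 1 is enough.\<close>
  consider "k = 0" | "k = 1" "odd d" | "k > 0" "even d" | "k \<ge> 2" "odd d"
    by fastforce
  then show ?case
  proof cases
    case 1
    then show ?thesis by (intro exI[of _ "[]"]) simp
  next
    case 2
    then show ?thesis
      by (intro exI[of _ "[1]"]) (auto simp: signed_powers_def cong_def odd_iff_mod_2_eq_one)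
  next
    case 3
    then obtain e where e: "d = 2 * e" by blast
    from 3 have k: "1 + (k - 1) = k" by simp
    obtain xs where xs: "set xs \<subseteq> signed_powers (k - 1)" "length xs \<le> (k - 1 + 1) div 2"
        "[sum_list xs = e] (mod 2 ^ (k - 1))"
      using less.IH[of "k - 1" e] 3 by auto
    show ?thesis
      using xs(2) signed_expansion_shift[OF xs(1,3), of 1, unfolded k] e
      by (intro exI[of _ "map ((*) (2 ^ 1)) xs"]) auto
  next
    case 4
    have "4 dvd d - 1 \<or> 4 dvd d - (-1)" using 4 by presburger
    then obtain s :: int where s: "s \<in> {1, -1}" "4 dvd d - s" by blast
    then obtain e where "d - s = 4 * e" by blast
    then have e: "d = s + 2 ^ 2 * e" by simp
    from 4 have k: "2 + (k - 2) = k" by simp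
    obtain xs where xs: "set xs \<subseteq> signed_powers (k - 2)" "length xs \<le> (k - 2 + 1) div 2"
        "[sum_list xs = e] (mod 2 ^ (k - 2))"
      using less.IH[of "k - 2" e] 4 by auto
    have "s \<in> signed_powers k"
      using s(1) 4 by (auto simp: signed_powers_def image_iff intro!: exI[of _ 0] bexI[of _ 0])
    moreover have "[s + sum_list (map ((*) (2 ^ 2)) xs) = d] (mod 2 ^ k)"
      unfolding e using signed_expansion_shift(2)[OF xs(1,3), of 2, unfolded k]
      by (intro cong_add) simp_all
    ultimately show ?thesis
      using xs(2) signed_expansion_shift(1)[OF xs(1,3), of 2, unfolded k] 4(1)
      by (intro exI[of _ "s # map ((*) (2 ^ 2)) xs"]) auto
  qed
qed

section \<open>Key sharing as a condition on differences\<close>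

text \<open>The sign of the power records which disjunct of \<open>shares_key\<close> holds. As
  integer differences, consecutive hops simply add up.\<close>

lemma shares_key_iff_diff:
  "shares_key k N i i' \<longleftrightarrow> (\<exists>x\<in>signed_powers k. [int i' - int i = x] (mod int N))"
proof -
  have "[i' = i + 2 ^ j] (mod N) \<longleftrightarrow> [int i' - int i = 2 ^ j] (mod int N)" for j
    by (simp add: cong_int_iff[symmetric] cong_iff_dvd_diff algebra_simps)
  moreover have "[i = i' + 2 ^ j] (mod N) \<longleftrightarrow> [int i' - int i = - (2 ^ j)] (mod int N)" for j
  proof -
    have "[i = i' + 2 ^ j] (mod N) \<longleftrightarrow> int N dvd - (int i - (int i' + 2 ^ j))"
      by (simp only: dvd_minus_iff cong_iff_dvd_diff[symmetric] cong_int_iff[symmetric]) simp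
    then show ?thesis
      by (simp add: cong_iff_dvd_diff algebra_simps)
  qed
  ultimately show ?thesis
    unfolding shares_key_def signed_powers_def by auto
qed

lemma obtain_node:
  fixes r :: int
  assumes "N > 0"
  obtains w where "w \<in> {1..N}" "[int w = r] (mod int N)"
proof
  \<comment> \<open>Shifting by one around the reduction yields a representative in
    \<open>{1..N}\<close> instead of \<open>{0..<N}\<close>; residue 0 becomes
    \<open>N\<close>.\<close>
  let ?w = "nat ((r - 1) mod int N) + 1"
  have nonneg: "0 \<le> (r - 1) mod int N" using assms by simp
  then show "?w \<in> {1..N}"
    using pos_mod_bound[of "int N" "r - 1"] assms by (auto simp: nat_less_iff Suc_le_eq)
  have "int ?w = (r - 1) mod int N + 1" using nonneg by simp
  then show "[int ?w = r] (mod int N)"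
    by (simp add: cong_def mod_simps)
qed

lemma node_unique:
  assumes "v \<in> {1..N}" "w \<in> {1..N}" "[int v = int w] (mod int N)"
  shows "v = w"
proof -
  have "int N dvd int v - int w" using assms(3) by (simp add: cong_iff_dvd_diff)
  moreover have "\<bar>int v - int w\<bar> < int N" using assms(1,2) by auto
  ultimately have "int v - int w = 0" using dvd_imp_le_int[of "int v - int w" "int N"] by force
  then show ?thesis by simp
qed

section \<open>Short paths\<close>

text \<open>A path repeats no vertex, hence no arc, so its length counts its set of arcs, and that
  set is contained in the arcs of the walk.\<close>

lemma (in wf_digraph) awalk_imp_apath_le:
  assumes "awalk u p v"
  shows "\<exists>q. apath u q v \<and> length q \<le> length p"
proof (intro exI conjI)
  let ?q = "awalk_to_apath p"
  show path: "apath u ?q v" using assms by (rule apath_awalk_to_apath)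
  have "distinct ?q"
    using path by (auto simp: apath_def awalk_verts_conv distinct_map split: if_splits)
  then have "length ?q = card (set ?q)" by (simp add: distinct_card)
  also have "\<dots> \<le> card (set p)"
    by (simp add: awalk_to_apath_subset[OF assms] card_mono)
  also have "\<dots> \<le> length p" by (rule card_length)
  finally show "length ?q \<le> length p" .
qed

text \<open>Each term of \<open>xs\<close> is spent as one hop. Only a walk results, since partial
  sums may revisit a node.\<close>

lemma key_graph_walk:
  assumes "u \<in> {1..N}" "v \<in> {1..N}" "set xs \<subseteq> signed_powers k"
    "[int v - int u = sum_list xs] (mod int N)"
  shows "\<exists>p. pre_digraph.awalk (with_proj (key_graph k N)) u p v \<and> length p = length xs"
  using assms
proof (induction xs arbitrary: u)
  case Nil
  then have "u = v"
    using node_unique[of v N u] by (simp add: cong_iff_dvd_diff)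
  with Nil show ?case
    by (intro exI[of _ "[]"])
      (simp add: pre_digraph.awalk_def cas_with_proj_eq key_graph_def)
next
  case (Cons x xs)
  have "N > 0" using Cons.prems(1) by auto
  then obtain w where w: "w \<in> {1..N}" "[int w = int u + x] (mod int N)"
    by (rule obtain_node)
  \<comment> \<open>The second summand is 0 modulo \<open>N\<close> by the choice of
    \<open>w\<close>. Adding it replaces \<open>u\<close> by \<open>w\<close>, after which
    \<open>x\<close> cancels.\<close>
  have "[(int v - int u) + (int u + x - int w) = sum_list (x # xs) + 0] (mod int N)"
    using Cons.prems(4) w(2) by (intro cong_add) (auto simp: cong_iff_dvd_diff dvd_diff_commute)
  then have "[int v - int w = sum_list xs] (mod int N)"
    by (simp add: cong_iff_dvd_diff algebra_simps)
  then obtain p where p: "pre_digraph.awalk (with_proj (key_graph k N)) w p v"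
      "length p = length xs"
    using Cons.IH[of w] Cons.prems w(1) by auto
  have "shares_key k N u w"
    using Cons.prems(3) w(2)
    by (auto simp: shares_key_iff_diff cong_iff_dvd_diff algebra_simps intro!: bexI[of _ x])
  with p Cons.prems(1) w(1) show ?case
    by (intro exI[of _ "(u, w) # p"])
      (auto simp: pre_digraph.awalk_def cas_with_proj_eq key_graph_def)
qed

lemma key_graph_short_path:
  assumes "N = 2 ^ k" "u \<in> {1..N}" "v \<in> {1..N}"
  shows "\<exists>p. pre_digraph.apath (with_proj (key_graph k N)) u p v \<and> length p \<le> (k + 1) div 2"
proof -
  interpret pair_graph "key_graph k N" using assms(1) by (rule pair_graph_key_graph)
  obtain xs where "set xs \<subseteq> signed_powers k" and len: "length xs \<le> (k + 1) div 2"
      and "[sum_list xs = int v - int u] (mod 2 ^ k)"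
    using signed_expansion by blast
  then obtain p where "awalk u p v" "length p = length xs"
    using key_graph_walk[of u N v xs k] assms by (auto simp: cong_sym)
  with awalk_imp_apath_le[of u p v] len show ?thesis by auto
qed

section \<open>Degrees\<close>

text \<open>The second range stops before \<open>k - 1\<close> because
  \<open>2 ^ k - 2 ^ (k - 1) = 2 ^ (k - 1)\<close> already occurs in the first family. This is the
  -1 in the degree.\<close>

lemma signed_powers_mod:
  assumes "k > 0"
  shows "(\<lambda>x. x mod 2 ^ k) ` signed_powers k
    = (\<lambda>j. 2 ^ j) ` {..<k} \<union> (\<lambda>j. 2 ^ k - 2 ^ j) ` {..<k - 1}"
proof -
  have pos: "(2 ^ j :: int) mod 2 ^ k = 2 ^ j" if "j < k" for j
    using that by simp
  have neg: "- (2 ^ j :: int) mod 2 ^ k = 2 ^ k - 2 ^ j" if "j < k" for j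
    using that by (simp add: zmod_zminus1_eq_if)
  have "(\<lambda>x. x mod 2 ^ k) ` signed_powers k
      = (\<lambda>j. 2 ^ j) ` {..<k} \<union> (\<lambda>j. 2 ^ k - 2 ^ j) ` {..<k}"
    by (simp add: signed_powers_def image_Un image_image pos neg cong: image_cong_simp)
  also have "{..<k} = insert (k - 1) {..<k - 1}" using assms by auto
  also have "(2::int) ^ k - 2 ^ (k - 1) = 2 ^ (k - 1)"
    using assms by (cases k) auto
  then have "(\<lambda>j. 2 ^ j :: int) ` insert (k - 1) {..<k - 1} \<union> (\<lambda>j. 2 ^ k - 2 ^ j) ` insert (k - 1) {..<k - 1}
     = (\<lambda>j. 2 ^ j) ` insert (k - 1) {..<k - 1} \<union> (\<lambda>j. 2 ^ k - 2 ^ j) ` {..<k - 1}"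
    by auto
  finally show ?thesis using \<open>{..<k} = insert (k - 1) {..<k - 1}\<close> by simp
qed

lemma card_signed_powers_mod:
  assumes "k > 0"
  shows "card ((\<lambda>x. x mod 2 ^ k) ` signed_powers k) = 2 * k - 1"
proof -
  have "(2::int) ^ j \<noteq> 2 ^ k - 2 ^ j'" if "j < k" "j' < k - 1" for j j'
  proof -
    \<comment> \<open>The midpoint \<open>2 ^ (k - 1)\<close> separates the families: positive
      powers do not exceed it, the others lie strictly above.\<close>
    have "(2::int) ^ j \<le> 2 ^ (k - 1)" "(2::int) ^ j' < 2 ^ (k - 1)"
      using that by (simp_all add: power_strict_increasing)
    moreover have "(2::int) ^ k = 2 * 2 ^ (k - 1)" using assms by (cases k) auto
    ultimately show ?thesis by linarith
  qed
  then have "(\<lambda>j. 2 ^ j :: int) ` {..<k} \<inter> (\<lambda>j. 2 ^ k - 2 ^ j) ` {..<k - 1} = {}"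
    by blast
  moreover have "card ((\<lambda>j. 2 ^ j :: int) ` {..<k}) = k"
    by (subst card_image) (auto simp: inj_on_def)
  moreover have "card ((\<lambda>j. 2 ^ k - 2 ^ j :: int) ` {..<k - 1}) = k - 1"
    by (subst card_image) (auto simp: inj_on_def)
  ultimately show ?thesis
    using assms by (simp add: signed_powers_mod card_Un_disjoint)
qed

text \<open>Neighbours of \<open>i\<close> correspond bijectively to residues of signed powers,
  through the difference from \<open>i\<close> modulo \<open>N\<close>.\<close>

lemma key_graph_degree:
  assumes "k > 0" "N = 2 ^ k" "i \<in> {1..N}"
  shows "card {i' \<in> {1..N}. i' \<noteq> i \<and> shares_key k N i i'} = 2 * k - 1"
proof -
  let ?A = "{i' \<in> {1..N}. i' \<noteq> i \<and> shares_key k N i i'}"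
  let ?f = "\<lambda>i'. (int i' - int i) mod int N"
  have "inj_on ?f ?A"
  proof (rule inj_onI)
    fix a b assume ab: "a \<in> ?A" "b \<in> ?A" "?f a = ?f b"
    then have "[int a = int b] (mod int N)"
      by (simp add: cong_def[symmetric] cong_iff_dvd_diff)
    with ab show "a = b" using node_unique[of a N b] by blast
  qed
  then have "card ?A = card (?f ` ?A)" by (simp add: card_image)
  also have "?f ` ?A = (\<lambda>x. x mod 2 ^ k) ` signed_powers k"
  proof (intro equalityI subsetI)
    fix y assume "y \<in> ?f ` ?A"
    then show "y \<in> (\<lambda>x. x mod 2 ^ k) ` signed_powers k"
      using assms(2) by (auto simp: shares_key_iff_diff cong_def)
  next
    fix y assume "y \<in> (\<lambda>x. x mod 2 ^ k) ` signed_powers k"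
    then obtain x where x: "x \<in> signed_powers k" "y = x mod int N"
      using assms(2) by auto
    have "N > 0" using assms(2) by simp
    then obtain w where w: "w \<in> {1..N}" "[int w = int i + x] (mod int N)"
      by (rule obtain_node)
    then have diff: "[int w - int i = x] (mod int N)"
      by (simp add: cong_iff_dvd_diff algebra_simps)
    with x have "shares_key k N i w" by (auto simp: shares_key_iff_diff)
    moreover from this have "w \<noteq> i" using shares_key_irrefl[OF assms(2)] by blast
    ultimately have "w \<in> ?A" using w by simp
    moreover have "y = ?f w" using diff x by (simp add: cong_def)
    ultimately show "y \<in> ?f ` ?A" by blast
  qed
  finally show ?thesis using card_signed_powers_mod[OF assms(1)] by simp
qed

theorem theorem1:
  fixes k N :: nat
  assumes "k \<ge> 3" and "N = 2 ^ k"
  shows "(\<forall>i\<in>{1..N}. real (card {i' \<in> {1..N}. i' \<noteq> i \<and> shares_key k N i i'}) = 2 * log 2 (real N) - 1) \<and>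
    (\<forall>u\<in>{1..N}. \<forall>v\<in>{1..N}. \<exists>p. pre_digraph.apath (with_proj (key_graph k N)) u p v \<and>
        int (length p) \<le> \<lfloor>log 2 (real N / 8) / 2\<rfloor> + 2)"
proof (intro conjI ballI)
  have log_N: "log 2 (real N) = real k"
    using assms(2) by (simp add: log_nat_power)
  fix i assume "i \<in> {1..N}"
  with assms show "real (card {i' \<in> {1..N}. i' \<noteq> i \<and> shares_key k N i i'}) = 2 * log 2 (real N) - 1"
    using key_graph_degree[of k N i] by (simp add: log_N of_nat_diff)
next
  fix u v assume uv: "u \<in> {1..N}" "v \<in> {1..N}"
  have "real N / 8 = 2 ^ (k - 3)"
    using assms by (simp add: power_diff)
  then have "log 2 (real N / 8) / 2 = real_of_int (int k - 3) / real_of_int 2"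
    using assms(1) by (simp add: log_nat_power of_nat_diff)
  then have "\<lfloor>log 2 (real N / 8) / 2\<rfloor> = (int k - 3) div 2"
    by (simp only: floor_divide_of_int_eq)
  \<comment> \<open>Adding 2 outside the division adds 4 to the numerator, turning
    \<open>k - 3\<close> into \<open>k + 1\<close>.\<close>
  then have "\<lfloor>log 2 (real N / 8) / 2\<rfloor> + 2 = int ((k + 1) div 2)"
    by (simp add: zdiv_int)
  with key_graph_short_path[OF assms(2) uv]
  show "\<exists>p. pre_digraph.apath (with_proj (key_graph k N)) u p v \<and>
      int (length p) \<le> \<lfloor>log 2 (real N / 8) / 2\<rfloor> + 2"
    by auto
qed

end
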